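(* Let $\alpha\in\mathbb{R}$ and $a=(1,-\alpha)\in\mathbb{R}^2$. Then the volume entropy of $(\mathbb{R}^3,g_a)$ is $$\delta(g_a)=\begin{cases}1-\alpha,&\text{if }\alpha<0,\\ 1,&\text{if }\alpha\in[0,1],\\ \alpha,&\text{if }\alpha>1.\end{cases}$$
   Context: For $a\in\mathbb{R}^N$, $g_a$ is the Riemannian metric on $\mathbb{R}^{N+1}$ given by $g_a=\sum_{i=1}^{N}e^{-2a_ix_{N+1}}\,dx_i^2+dx_{N+1}^2$; here $N=2$. The space $(\mathbb{R}^{N+1},g_a)$ is homogeneous. Its volume entropy is $\delta(g_a)=\lim_{r\to\infty}\frac{\log \operatorname{Vol}(B(x,r))}{r}$, where $B(x,r)$ is the geodesic ball of center $x$ and radius $r$; by homogeneity it does not depend on $x$. *)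

theory Defs
  imports "HOL-Analysis.Analysis"
begin

text \<open>A Riemannian metric on \<open>\<real>\<^sup>n\<close> is given by its matrix of coefficients in the standard
  coordinates, as a function of the point.\<close>

definition riem_speed :: "(real^'n \<Rightarrow> real^'n^'n) \<Rightarrow> (real \<Rightarrow> real^'n) \<Rightarrow> real \<Rightarrow> real" where
  "riem_speed g \<gamma> t =
     sqrt (vector_derivative \<gamma> (at t) \<bullet> (g (\<gamma> t) *v vector_derivative \<gamma> (at t)))"

text \<open>The library's piecewise \<open>C\<^sup>1\<close> curves may have unbounded derivative near the exceptional
  points, hence infinite length; \<open>has_integral\<close> (rather than \<open>integral\<close>, which would then be 0)
  excludes these from the infimum.\<close>

definition riem_dist :: "(real^'n \<Rightarrow> real^'n^'n) \<Rightarrow> real^'n \<Rightarrow> real^'n \<Rightarrow> real" where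
  "riem_dist g x y =
     Inf {L. \<exists>\<gamma>. \<gamma> piecewise_C1_differentiable_on {0..1} \<and> \<gamma> 0 = x \<and> \<gamma> 1 = y \<and>
                 (riem_speed g \<gamma> has_integral L) {0..1}}"

definition riem_ball :: "(real^'n \<Rightarrow> real^'n^'n) \<Rightarrow> real^'n \<Rightarrow> real \<Rightarrow> (real^'n) set" where
  "riem_ball g x r = {y. riem_dist g x y < r}"

definition riem_volume :: "(real^'n \<Rightarrow> real^'n^'n) \<Rightarrow> (real^'n) measure" where
  "riem_volume g = density lborel (\<lambda>p. ennreal (sqrt (det (g p))))"

text \<open>Existence of the limit and its independence of the centre are part of the notion.\<close>

definition has_volume_entropy :: "(real^'n \<Rightarrow> real^'n^'n) \<Rightarrow> real \<Rightarrow> bool" where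
  "has_volume_entropy g \<delta> \<longleftrightarrow>
     (\<forall>x. ((\<lambda>r. ln (measure (riem_volume g) (riem_ball g x r)) / r) \<longlongrightarrow> \<delta>) at_top)"

definition metric_g :: "real^2 \<Rightarrow> real^3 \<Rightarrow> real^3^3" where
  "metric_g a x = vector
     [vector [exp (- 2 * a $ 1 * x $ 3), 0, 0],
      vector [0, exp (- 2 * a $ 2 * x $ 3), 0],
      vector [0, 0, 1]]"

end

theory Submission
  imports Defs "HOL-Real_Asymp.Real_Asymp"
begin

text \<open>The entropy is found for every \<open>a\<close> in the plane: it is the larger of the sum \<open>P\<close> of the positive
  parts and the sum \<open>Q\<close> of the negative parts of the \<open>a $ n\<close>.

  A curve of length less than \<open>r\<close> whose heights range over \<open>[m, H]\<close> has \<open>H - m < r\<close> and moves the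
  \<open>n\<close>-th horizontal coordinate by at most \<open>r * exp (max (a $ n * m) (a $ n * H))\<close>. Weighted by the
  volume density \<open>exp (- (a $ 1 + a $ 2) * z)\<close>, the endpoints at height \<open>z\<close> contribute at most
  \<open>4 * r\<^sup>2 * exp (P * (H - z) + Q * (z - m))\<close>, and rounding \<open>m\<close>, \<open>H\<close> and \<open>z\<close> to integers leaves only
  polynomially many such contributions. Conversely, moving vertically by \<open>r - O(1)\<close>, downwards for \<open>P\<close>
  and upwards for \<open>Q\<close>, and changing each horizontal coordinate at the cheaper end reaches a box of
  volume at least a constant times \<open>exp (P * r)\<close> or \<open>exp (Q * r)\<close>.\<close>

section \<open>Lengths of curves for a general metric\<close>

definition curve_of_length :: "(real^'n \<Rightarrow> real^'n^'n) \<Rightarrow> real^'n \<Rightarrow> real^'n \<Rightarrow> real \<Rightarrow> bool" where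
  "curve_of_length g x y L \<longleftrightarrow>
     (\<exists>\<gamma>. valid_path \<gamma> \<and> \<gamma> 0 = x \<and> \<gamma> 1 = y \<and> (riem_speed g \<gamma> has_integral L) {0..1})"

lemma riem_dist_eq_Inf: "riem_dist g x y = Inf {L. curve_of_length g x y L}"
  by (simp add: riem_dist_def curve_of_length_def valid_path_def)

text \<open>The quadratic form scales by \<open>c * c\<close>, and \<open>sqrt\<close> is
  multiplicative on all reals, so \<open>g\<close> may be any matrix field.\<close>

lemma riem_speed_scaled:
  assumes "\<gamma> t = \<gamma>' t'" "vector_derivative \<gamma> (at t) = c *\<^sub>R vector_derivative \<gamma>' (at t')" "0 \<le> c"
  shows "riem_speed g \<gamma> t = c * riem_speed g \<gamma>' t'"
  using assms
  by (simp add: riem_speed_def matrix_vector_mult_scaleR real_sqrt_mult mult.assoc[symmetric])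

text \<open>Each half of the joined path is an affine reparametrisation with factor 2, which doubles
  the speed and halves the parameter interval. This can fail only at finitely many points, which do
  not affect the integral.\<close>

lemma riem_speed_join:
  assumes 1: "(riem_speed g \<gamma>1 has_integral L1) {0..1}"
    and 2: "(riem_speed g \<gamma>2 has_integral L2) {0..1}"
    and v: "valid_path \<gamma>1" "valid_path \<gamma>2"
  shows "(riem_speed g (\<gamma>1 +++ \<gamma>2) has_integral (L1 + L2)) {0..1}"
proof -
  obtain s1 s2
    where s1: "finite s1" "\<forall>x\<in>{0..1} - s1. \<gamma>1 differentiable at x"
      and s2: "finite s2" "\<forall>x\<in>{0..1} - s2. \<gamma>2 differentiable at x"
    using v by (auto simp: valid_path_def piecewise_C1_differentiable_on_def C1_differentiable_on_eq)
  have i1: "((\<lambda>x. 2 * riem_speed g \<gamma>1 (2*x)) has_integral L1) {0..1/2}"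
    using has_integral_affinity01 [OF 1, where m= 2 and c=0, THEN has_integral_cmul [where c=2]]
    by (simp only: image_affinity_atLeastAtMost_div_diff) (simp add: mult_ac)
  have i2: "((\<lambda>x. 2 * riem_speed g \<gamma>2 (2*x - 1)) has_integral L2) {1/2..1}"
    using has_integral_affinity01 [OF 2, where m= 2 and c="-1", THEN has_integral_cmul [where c=2]]
    by (simp only: image_affinity_atLeastAtMost_div_diff) (simp add: mult_ac)
  have d1: "vector_derivative (\<gamma>1 +++ \<gamma>2) (at z) = 2 *\<^sub>R vector_derivative \<gamma>1 (at (2*z))"
    if "0 \<le> z" "z*2 < 1" "2*z \<notin> s1" for z
  proof (rule vector_derivative_at [OF has_vector_derivative_transform_within])
    \<comment> \<open>Within this radius the parameter stays on one side of the junction, where the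
      joined path is a rescaling of a single piece.\<close>
    show "0 < \<bar>z - 1/2\<bar>"
      using that by auto
    have "((*) 2 has_vector_derivative 2) (at z)"
      by (simp add: has_vector_derivative_def has_derivative_def bounded_linear_mult_left)
    moreover have "(\<gamma>1 has_vector_derivative vector_derivative \<gamma>1 (at (2 * z))) (at (2 * z))"
      using s1 that by (auto simp: vector_derivative_works)
    ultimately
    show "((\<lambda>x. \<gamma>1 (2 * x)) has_vector_derivative 2 *\<^sub>R vector_derivative \<gamma>1 (at (2 * z))) (at z)"
      by (intro vector_diff_chain_at [simplified o_def])
  qed (use that in \<open>simp_all add: joinpaths_def dist_real_def abs_if split: if_split_asm\<close>)
  have d2: "vector_derivative (\<gamma>1 +++ \<gamma>2) (at z) = 2 *\<^sub>R vector_derivative \<gamma>2 (at (2*z - 1))"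
    if "1 < z*2" "z \<le> 1" "2*z - 1 \<notin> s2" for z
  proof (rule vector_derivative_at [OF has_vector_derivative_transform_within])
    show "0 < \<bar>z - 1/2\<bar>"
      using that by auto
    have "((\<lambda>x. 2 * x - 1) has_vector_derivative 2) (at z)"
      by (simp add: has_vector_derivative_def has_derivative_def bounded_linear_mult_left)
    moreover have "(\<gamma>2 has_vector_derivative vector_derivative \<gamma>2 (at (2 * z - 1))) (at (2 * z - 1))"
      using s2 that by (auto simp: vector_derivative_works)
    ultimately
    show "((\<lambda>x. \<gamma>2 (2 * x - 1)) has_vector_derivative 2 *\<^sub>R vector_derivative \<gamma>2 (at (2 * z - 1))) (at z)"
      by (intro vector_diff_chain_at [simplified o_def])
  qed (use that in \<open>simp_all add: joinpaths_def dist_real_def abs_if split: if_split_asm\<close>)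
  have "(riem_speed g (\<gamma>1 +++ \<gamma>2) has_integral L1) {0..1/2}"
  proof (rule has_integral_spike_finite [OF _ _ i1])
    show "finite (insert (1/2) ((*) 2 -` s1))"
      using s1 by (force intro: finite_vimageI [where h = "(*)2"] inj_onI)
    show "riem_speed g (\<gamma>1 +++ \<gamma>2) x = 2 * riem_speed g \<gamma>1 (2 * x)"
      if "x \<in> {0..1/2} - insert (1/2) ((*) 2 -` s1)" for x
      using that by (intro riem_speed_scaled d1) (auto simp: joinpaths_def)
  qed
  moreover have "(riem_speed g (\<gamma>1 +++ \<gamma>2) has_integral L2) {1/2..1}"
  proof (rule has_integral_spike_finite [OF _ _ i2])
    show "finite (insert (1/2) ((\<lambda>x. 2 * x - 1) -` s2))"
      using s2 by (force intro: finite_vimageI [where h = "\<lambda>x. 2*x-1"] inj_onI)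
    show "riem_speed g (\<gamma>1 +++ \<gamma>2) x = 2 * riem_speed g \<gamma>2 (2 * x - 1)"
      if "x \<in> {1/2..1} - insert (1/2) ((\<lambda>x. 2 * x - 1) -` s2)" for x
      using that by (intro riem_speed_scaled d2) (auto simp: joinpaths_def)
  qed
  ultimately show ?thesis
    by (simp add: has_integral_combine [where c = "1/2"])
qed

lemma curve_of_length_trans:
  assumes "curve_of_length g x y L1" "curve_of_length g y z L2"
  shows "curve_of_length g x z (L1 + L2)"
proof -
  obtain \<gamma>1 \<gamma>2 where
    1: "valid_path \<gamma>1" "\<gamma>1 0 = x" "\<gamma>1 1 = y" "(riem_speed g \<gamma>1 has_integral L1) {0..1}" and
    2: "valid_path \<gamma>2" "\<gamma>2 0 = y" "\<gamma>2 1 = z" "(riem_speed g \<gamma>2 has_integral L2) {0..1}"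
    using assms unfolding curve_of_length_def by blast
  have "valid_path (\<gamma>1 +++ \<gamma>2)"
    using 1 2 by (intro valid_path_join) (auto simp: pathstart_def pathfinish_def)
  moreover have "(\<gamma>1 +++ \<gamma>2) 0 = x" "(\<gamma>1 +++ \<gamma>2) 1 = z"
    using 1 2 by (auto simp: joinpaths_def)
  ultimately show ?thesis
    unfolding curve_of_length_def using riem_speed_join[OF 1(4) 2(4) 1(1) 2(1)] by blast
qed

lemma curve_of_length_linepath:
  assumes "\<And>t. t \<in> {0..1} \<Longrightarrow> riem_speed g (linepath x y) t = L"
  shows "curve_of_length g x y L"
proof -
  have "((\<lambda>t. L) has_integral L) {0..1::real}"
    using has_integral_const_real[of L 0 1] by simp
  then have "(riem_speed g (linepath x y) has_integral L) {0..1}"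
    by (rule has_integral_eq[rotated]) (simp add: assms)
  then show ?thesis
    unfolding curve_of_length_def
    by (intro exI[of _ "linepath x y"] conjI valid_path_linepath) (simp_all add: linepath_def)
qed

text \<open>The increment is the integral of the component's derivative over \<open>[s, t]\<close>,
  hence at most \<open>C\<close> times the integral of the speed there; as the speed is nonnegative,
  that integral is at most the full length \<open>L\<close>.\<close>

lemma path_component_increment_le:
  fixes \<gamma> :: "real \<Rightarrow> real^'n"
  assumes \<gamma>: "valid_path \<gamma>" and L: "(riem_speed g \<gamma> has_integral L) {0..1}"
    and pos: "\<And>u. 0 \<le> riem_speed g \<gamma> u"
    and st: "0 \<le> s" "s \<le> t" "t \<le> 1" and C: "0 \<le> C"
    and le: "\<And>u. u \<in> {s..t} \<Longrightarrow> \<bar>vector_derivative \<gamma> (at u) $ i\<bar> \<le> C * riem_speed g \<gamma> u"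
  shows "\<bar>\<gamma> t $ i - \<gamma> s $ i\<bar> \<le> C * L"
proof -
  obtain S where S: "finite S" "\<forall>x\<in>{0..1} - S. \<gamma> differentiable at x" "continuous_on {0..1} \<gamma>"
    using \<gamma> by (auto simp: valid_path_def piecewise_C1_differentiable_on_def C1_differentiable_on_eq)
  have ftc: "((\<lambda>u. vector_derivative \<gamma> (at u) $ i) has_integral (\<gamma> t $ i - \<gamma> s $ i)) {s..t}"
  proof (rule fundamental_theorem_of_calculus_interior_strong[OF S(1) st(2)])
    show "((\<lambda>u. \<gamma> u $ i) has_vector_derivative vector_derivative \<gamma> (at x) $ i) (at x)"
      if "x \<in> {s<..<t} - S" for x
    proof -
      have "(\<gamma> has_vector_derivative vector_derivative \<gamma> (at x)) (at x)"
        using S(2) that st by (auto simp: vector_derivative_works)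
      then show ?thesis
        using bounded_linear.has_vector_derivative[OF bounded_linear_vec_nth] by blast
    qed
    show "continuous_on {s..t} (\<lambda>u. \<gamma> u $ i)"
      using S(3) st by (intro continuous_intros) (auto elim: continuous_on_subset)
  qed
  have int: "riem_speed g \<gamma> integrable_on {s..t}"
    by (rule integrable_on_subinterval[OF has_integral_integrable[OF L]]) (use st in auto)
  have "\<bar>\<gamma> t $ i - \<gamma> s $ i\<bar> \<le> integral {s..t} (\<lambda>u. C * riem_speed g \<gamma> u)"
    using integral_norm_bound_integral[OF has_integral_integrable[OF ftc]
        integrable_on_mult_right[OF int], of C] le
    by (simp add: integral_unique[OF ftc])
  also have "\<dots> = C * integral {s..t} (riem_speed g \<gamma>)"
    by simp
  also have "integral {s..t} (riem_speed g \<gamma>) \<le> integral {0..1} (riem_speed g \<gamma>)"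
    by (rule integral_subset_le[OF _ int has_integral_integrable[OF L]]) (use st pos in auto)
  also have "\<dots> = L"
    using L by (rule integral_unique)
  finally show ?thesis
    using C by (simp add: mult_left_mono)
qed

section \<open>Curves and balls of \<open>metric_g a\<close>\<close>

lemma metric_g_quadratic:
  "v \<bullet> (metric_g a p *v v) =
     exp (- 2 * a $ 1 * p $ 3) * (v $ 1)\<^sup>2 + exp (- 2 * a $ 2 * p $ 3) * (v $ 2)\<^sup>2 + (v $ 3)\<^sup>2"
  by (simp add: metric_g_def inner_vec_def matrix_vector_mult_def sum_3 power2_eq_square algebra_simps)

lemma det_metric_g: "sqrt (det (metric_g a p)) = exp (- (a $ 1 + a $ 2) * p $ 3)"
proof -
  have "det (metric_g a p) = (exp (- (a $ 1 + a $ 2) * p $ 3))\<^sup>2"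
    by (simp add: det_3 metric_g_def power2_eq_square exp_add[symmetric] algebra_simps)
  then show ?thesis
    by simp
qed

lemma riem_speed_metric_g_nonneg: "0 \<le> riem_speed (metric_g a) \<gamma> t"
  by (simp add: riem_speed_def metric_g_quadratic)

text \<open>The squared speed is a sum of three squares, so it dominates each of them.\<close>

lemma riem_speed_metric_g_component:
  fixes \<gamma> :: "real \<Rightarrow> real^3"
  defines "v \<equiv> \<lambda>t. vector_derivative \<gamma> (at t)"
  shows "\<bar>v t $ 1\<bar> \<le> exp (a $ 1 * \<gamma> t $ 3) * riem_speed (metric_g a) \<gamma> t"
    and "\<bar>v t $ 2\<bar> \<le> exp (a $ 2 * \<gamma> t $ 3) * riem_speed (metric_g a) \<gamma> t"
    and "\<bar>v t $ 3\<bar> \<le> riem_speed (metric_g a) \<gamma> t"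
proof -
  define e where "e i = exp (a $ i * \<gamma> t $ 3)" for i
  have e: "exp (- 2 * a $ i * \<gamma> t $ 3) = 1 / (e i)\<^sup>2" "e i > 0" for i
    by (simp_all add: e_def exp_minus power2_eq_square exp_add[symmetric] field_simps)
  have sp: "riem_speed (metric_g a) \<gamma> t = sqrt ((v t $ 1)\<^sup>2 / (e 1)\<^sup>2 + (v t $ 2)\<^sup>2 / (e 2)\<^sup>2 + (v t $ 3)\<^sup>2)"
    unfolding riem_speed_def metric_g_quadratic e v_def by simp
  have "\<bar>v t $ 1\<bar> / e 1 \<le> riem_speed (metric_g a) \<gamma> t" "\<bar>v t $ 2\<bar> / e 2 \<le> riem_speed (metric_g a) \<gamma> t"
    "\<bar>v t $ 3\<bar> \<le> riem_speed (metric_g a) \<gamma> t"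
    unfolding sp by (auto intro!: real_le_rsqrt simp: power_divide)
  then show "\<bar>v t $ 1\<bar> \<le> exp (a $ 1 * \<gamma> t $ 3) * riem_speed (metric_g a) \<gamma> t"
     "\<bar>v t $ 2\<bar> \<le> exp (a $ 2 * \<gamma> t $ 3) * riem_speed (metric_g a) \<gamma> t"
     "\<bar>v t $ 3\<bar> \<le> riem_speed (metric_g a) \<gamma> t"
    using e(2) by (auto simp: e_def[symmetric] field_simps)
qed

text \<open>The speed is constant along each of these segments: the horizontal ones stay at one
  height, and the vertical direction has coefficient 1 everywhere.\<close>

lemma curve_of_length_axis:
  "curve_of_length (metric_g a) (vector [x, y, z]) (vector [x', y, z]) (exp (- a $ 1 * z) * \<bar>x' - x\<bar>)"
  "curve_of_length (metric_g a) (vector [x, y, z]) (vector [x, y', z]) (exp (- a $ 2 * z) * \<bar>y' - y\<bar>)"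
  "curve_of_length (metric_g a) (vector [x, y, z]) (vector [x, y, z']) \<bar>z' - z\<bar>"
proof -
  have sq: "exp (- (2 * a $ i * z)) = (exp (- a $ i * z))\<^sup>2" for i
    by (simp add: power2_eq_square exp_add[symmetric])
  show
    "curve_of_length (metric_g a) (vector [x, y, z]) (vector [x', y, z]) (exp (- a $ 1 * z) * \<bar>x' - x\<bar>)"
    "curve_of_length (metric_g a) (vector [x, y, z]) (vector [x, y', z]) (exp (- a $ 2 * z) * \<bar>y' - y\<bar>)"
    "curve_of_length (metric_g a) (vector [x, y, z]) (vector [x, y, z']) \<bar>z' - z\<bar>"
    by (rule curve_of_length_linepath;
        simp add: riem_speed_def metric_g_quadratic linepath_def real_sqrt_mult sq
          flip: distrib_right)+
qed

lemma vector_3_collapse: "vector [p $ 1, p $ 2, p $ 3] = (p :: 'a::zero^3)"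
  by (simp add: vec_eq_iff forall_3)

text \<open>Each horizontal coordinate may be changed before the vertical move, at height
  \<open>p $ 3\<close>, or after it, at height \<open>q $ 3\<close>. The four combinations yield the
  two minima.\<close>

lemma curve_of_length_metric_g:
  fixes p q :: "real^3"
  shows "curve_of_length (metric_g a) p q
     (min (exp (- a $ 1 * p $ 3)) (exp (- a $ 1 * q $ 3)) * \<bar>q $ 1 - p $ 1\<bar> +
      min (exp (- a $ 2 * p $ 3)) (exp (- a $ 2 * q $ 3)) * \<bar>q $ 2 - p $ 2\<bar> + \<bar>q $ 3 - p $ 3\<bar>)"
proof -
  let ?J = "curve_of_length (metric_g a)"
  let ?x = "\<lambda>z. exp (- a $ 1 * z) * \<bar>q $ 1 - p $ 1\<bar>" and ?y = "\<lambda>z. exp (- a $ 2 * z) * \<bar>q $ 2 - p $ 2\<bar>"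
  let ?z = "\<bar>q $ 3 - p $ 3\<bar>"
  note T = curve_of_length_trans and A = curve_of_length_axis[where a = a]
  have "?J p q (?x (p $ 3) + ?y (p $ 3) + ?z)"
    using T[OF T[OF A(1) A(2)] A(3), of "p $ 1" "p $ 2" "p $ 3" "q $ 1" "q $ 2" "q $ 3"]
    by (simp add: vector_3_collapse algebra_simps)
  moreover have "?J p q (?x (p $ 3) + ?y (q $ 3) + ?z)"
    using T[OF T[OF A(1) A(3)] A(2), of "p $ 1" "p $ 2" "p $ 3" "q $ 1" "q $ 2" "q $ 3"]
    by (simp add: vector_3_collapse algebra_simps)
  moreover have "?J p q (?x (q $ 3) + ?y (p $ 3) + ?z)"
    using T[OF T[OF A(2) A(3)] A(1), of "p $ 1" "p $ 2" "p $ 3" "q $ 1" "q $ 2" "q $ 3"]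
    by (simp add: vector_3_collapse algebra_simps)
  moreover have "?J p q (?x (q $ 3) + ?y (q $ 3) + ?z)"
    using T[OF T[OF A(3) A(1)] A(2), of "p $ 1" "p $ 2" "p $ 3" "q $ 1" "q $ 2" "q $ 3"]
    by (simp add: vector_3_collapse algebra_simps)
  ultimately show ?thesis
    unfolding min_def by (simp split: if_split)
qed

text \<open>The infimum lies below \<open>r\<close> exactly when some length does, because the set
  of lengths is nonempty by the axis-parallel paths and bounded below by 0.\<close>

lemma mem_riem_ball_metric_g:
  "q \<in> riem_ball (metric_g a) p r \<longleftrightarrow> (\<exists>L<r. curve_of_length (metric_g a) p q L)"
proof -
  have "{L. curve_of_length (metric_g a) p q L} \<noteq> {}"
    using curve_of_length_metric_g by blast
  moreover have "bdd_below {L. curve_of_length (metric_g a) p q L}"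
    by (rule bdd_belowI[of _ 0])
      (auto simp: curve_of_length_def intro: has_integral_nonneg riem_speed_metric_g_nonneg)
  ultimately show ?thesis
    by (auto simp: riem_ball_def riem_dist_eq_Inf cInf_less_iff)
qed

text \<open>A curve of length \<open>L < r\<close> to \<open>q\<close> is prolonged to nearby points
  by axis-parallel paths, whose length is continuous in the endpoint and vanishes at
  \<open>q\<close>. Openness gives the measurability behind the lower volume bound.\<close>

lemma open_riem_ball_metric_g: "open (riem_ball (metric_g a) p r)"
proof (subst open_subopen, intro ballI)
  fix q assume "q \<in> riem_ball (metric_g a) p r"
  then obtain L where L: "L < r" "curve_of_length (metric_g a) p q L"
    by (auto simp: mem_riem_ball_metric_g)
  define d where "d q' = min (exp (- a $ 1 * q $ 3)) (exp (- a $ 1 * q' $ 3)) * \<bar>q' $ 1 - q $ 1\<bar> +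
      min (exp (- a $ 2 * q $ 3)) (exp (- a $ 2 * q' $ 3)) * \<bar>q' $ 2 - q $ 2\<bar> + \<bar>q' $ 3 - q $ 3\<bar>"
    for q' :: "real^3"
  have "open {q'. d q' < r - L}"
    unfolding d_def by (intro open_Collect_less continuous_intros)
  moreover have "q \<in> {q'. d q' < r - L}"
    using L by (simp add: d_def)
  moreover have "q' \<in> riem_ball (metric_g a) p r" if "d q' < r - L" for q'
  proof -
    have "curve_of_length (metric_g a) p q' (L + d q')"
      using curve_of_length_trans[OF L(2) curve_of_length_metric_g[of a q q']] by (simp add: d_def)
    moreover have "L + d q' < r"
      using that by simp
    ultimately show ?thesis
      unfolding mem_riem_ball_metric_g by blast
  qed
  ultimately show "\<exists>T. open T \<and> q \<in> T \<and> T \<subseteq> riem_ball (metric_g a) p r"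
    by blast
qed

lemma riem_ball_height_range:
  assumes "q \<in> riem_ball (metric_g a) p r"
  obtains m H where "m \<le> p $ 3" "p $ 3 \<le> H" "m \<le> q $ 3" "q $ 3 \<le> H" "H - m < r"
    "\<bar>q $ 1 - p $ 1\<bar> \<le> r * exp (max (a $ 1 * m) (a $ 1 * H))"
    "\<bar>q $ 2 - p $ 2\<bar> \<le> r * exp (max (a $ 2 * m) (a $ 2 * H))"
proof -
  let ?g = "metric_g a"
  obtain L where "L < r" "curve_of_length ?g p q L"
    using assms by (auto simp: mem_riem_ball_metric_g)
  then obtain \<gamma> where \<gamma>: "valid_path \<gamma>" "\<gamma> 0 = p" "\<gamma> 1 = q" "(riem_speed ?g \<gamma> has_integral L) {0..1}"
    by (auto simp: curve_of_length_def)
  have cont: "continuous_on {0..1} (\<lambda>t. \<gamma> t $ 3)"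
    using \<gamma>(1) by (auto simp: valid_path_def piecewise_C1_differentiable_on_def intro!: continuous_intros)
  \<comment> \<open>The lowest and highest points of the curve, at parameters \<open>s\<close> and
    \<open>t\<close>, provide \<open>m\<close> and \<open>H\<close>.\<close>
  obtain s where s: "s \<in> {0..1}" "\<And>u. u \<in> {0..1} \<Longrightarrow> \<gamma> s $ 3 \<le> \<gamma> u $ 3"
    using continuous_attains_inf[OF compact_Icc _ cont] by auto
  obtain t where t: "t \<in> {0..1}" "\<And>u. u \<in> {0..1} \<Longrightarrow> \<gamma> u $ 3 \<le> \<gamma> t $ 3"
    using continuous_attains_sup[OF compact_Icc _ cont] by auto
  note incr = path_component_increment_le[OF \<gamma>(1,4) riem_speed_metric_g_nonneg]
  \<comment> \<open>The curve may pass its extreme points in either order, hence \<open>min\<close>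
    and \<open>max\<close>.\<close>
  have "\<bar>\<gamma> (max s t) $ 3 - \<gamma> (min s t) $ 3\<bar> \<le> 1 * L"
    using s(1) t(1) by (intro incr) (auto simp: riem_speed_metric_g_component)
  then have osc: "\<gamma> t $ 3 - \<gamma> s $ 3 \<le> L"
    by (auto simp: max_def min_def split: if_splits)
  \<comment> \<open>The exponential is monotone in the height, so it is largest at the highest or
    the lowest point, according to the sign of \<open>a $ i\<close>.\<close>
  have exp_le: "exp (a $ i * \<gamma> u $ 3) \<le> exp (max (a $ i * \<gamma> s $ 3) (a $ i * \<gamma> t $ 3))"
    if "u \<in> {0..1}" for u i
  proof (cases "a $ i \<ge> 0")
    case True
    then show ?thesis
      using t(2)[OF that] by (simp add: mult_left_mono le_max_iff_disj)
  next
    case False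
    then show ?thesis
      using s(2)[OF that] by (simp add: mult_left_mono_neg le_max_iff_disj)
  qed
  \<comment> \<open>Coordinates are indexed by type \<open>3\<close> and exponents by type
    \<open>2\<close>, hence the separate \<open>i\<close> and \<open>i'\<close>.\<close>
  have spread: "\<bar>q $ i - p $ i\<bar> \<le> r * exp (max (a $ i' * \<gamma> s $ 3) (a $ i' * \<gamma> t $ 3))"
    if le: "\<And>u. \<bar>vector_derivative \<gamma> (at u) $ i\<bar> \<le> exp (a $ i' * \<gamma> u $ 3) * riem_speed ?g \<gamma> u"
    for i and i' :: 2
  proof -
    let ?C = "exp (max (a $ i' * \<gamma> s $ 3) (a $ i' * \<gamma> t $ 3))"
    have "\<bar>\<gamma> 1 $ i - \<gamma> 0 $ i\<bar> \<le> ?C * L"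
    proof (rule incr)
      fix u :: real assume "u \<in> {0..1}"
      then show "\<bar>vector_derivative \<gamma> (at u) $ i\<bar> \<le> ?C * riem_speed ?g \<gamma> u"
        using order_trans[OF le mult_right_mono[OF exp_le riem_speed_metric_g_nonneg]] by blast
    qed auto
    also have "\<dots> \<le> ?C * r"
      using \<open>L < r\<close> by simp
    finally show ?thesis
      using \<gamma> by (simp add: mult.commute)
  qed
  show thesis
  proof (rule that)
    show "\<bar>q $ 1 - p $ 1\<bar> \<le> r * exp (max (a $ 1 * \<gamma> s $ 3) (a $ 1 * \<gamma> t $ 3))"
      "\<bar>q $ 2 - p $ 2\<bar> \<le> r * exp (max (a $ 2 * \<gamma> s $ 3) (a $ 2 * \<gamma> t $ 3))"
      by (rule spread, rule riem_speed_metric_g_component)+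
  qed (use s(2)[of 0] s(2)[of 1] t(2)[of 0] t(2)[of 1] \<gamma> osc \<open>L < r\<close> in auto)
qed

section \<open>Riemannian volume of boxes\<close>

lemma emeasure_lborel_cbox_3:
  fixes l u :: "real^3"
  assumes "\<And>i. l $ i \<le> u $ i"
  shows "emeasure lborel (cbox l u) = ennreal ((u $ 1 - l $ 1) * (u $ 2 - l $ 2) * (u $ 3 - l $ 3))"
proof -
  have ne: "cbox l u \<noteq> {}"
    using assms by (simp add: interval_ne_empty_cart)
  have "measure lborel (cbox l u) = (u $ 1 - l $ 1) * (u $ 2 - l $ 2) * (u $ 3 - l $ 3)"
    unfolding content_cbox_cart[OF ne] UNIV_3 by simp
  moreover have "emeasure lborel (cbox l u) \<noteq> top"
    using emeasure_lborel_cbox_finite[of l u] by simp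
  ultimately show ?thesis
    by (simp add: emeasure_eq_ennreal_measure)
qed

lemma emeasure_riem_volume_metric_g:
  assumes "S \<in> sets borel"
  shows "emeasure (riem_volume (metric_g a)) S =
    (\<integral>\<^sup>+p. ennreal (exp (- (a $ 1 + a $ 2) * p $ 3)) * indicator S p \<partial>lborel)"
proof -
  have "(\<lambda>p. exp (- (a $ 1 + a $ 2) * p $ 3)) \<in> borel_measurable (borel :: (real^3) measure)"
    by (intro borel_measurable_continuous_onI continuous_intros)
  then show ?thesis
    unfolding riem_volume_def det_metric_g using assms by (simp add: emeasure_density)
qed

lemma emeasure_riem_volume_cbox_le:
  fixes l u :: "real^3"
  assumes lu: "\<And>i. l $ i \<le> u $ i" and D: "0 \<le> D"
    and le: "\<And>p. p \<in> cbox l u \<Longrightarrow> exp (- (a $ 1 + a $ 2) * p $ 3) \<le> D"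
  shows "emeasure (riem_volume (metric_g a)) (cbox l u)
    \<le> ennreal (D * ((u $ 1 - l $ 1) * (u $ 2 - l $ 2) * (u $ 3 - l $ 3)))"
proof -
  have "emeasure (riem_volume (metric_g a)) (cbox l u)
      \<le> (\<integral>\<^sup>+p. ennreal D * indicator (cbox l u) p \<partial>lborel)"
    using le by (subst emeasure_riem_volume_metric_g)
      (auto intro!: nn_integral_mono ennreal_leI split: split_indicator)
  then show ?thesis
    using D lu by (simp add: nn_integral_cmult_indicator emeasure_lborel_cbox_3 ennreal_mult)
qed

lemma emeasure_riem_volume_cbox_ge:
  fixes l u :: "real^3"
  assumes lu: "\<And>i. l $ i \<le> u $ i" and D: "0 \<le> D"
    and ge: "\<And>p. p \<in> cbox l u \<Longrightarrow> D \<le> exp (- (a $ 1 + a $ 2) * p $ 3)"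
  shows "ennreal (D * ((u $ 1 - l $ 1) * (u $ 2 - l $ 2) * (u $ 3 - l $ 3)))
    \<le> emeasure (riem_volume (metric_g a)) (cbox l u)"
proof -
  have "(\<integral>\<^sup>+p. ennreal D * indicator (cbox l u) p \<partial>lborel)
      \<le> emeasure (riem_volume (metric_g a)) (cbox l u)"
    using ge by (subst emeasure_riem_volume_metric_g)
      (auto intro!: nn_integral_mono ennreal_leI split: split_indicator)
  then show ?thesis
    using D lu by (simp add: nn_integral_cmult_indicator emeasure_lborel_cbox_3 ennreal_mult)
qed

section \<open>Upper bound for the volume of balls\<close>

definition entropy_exponent :: "real^2 \<Rightarrow> real" where
  "entropy_exponent a = max (max 0 (a $ 1) + max 0 (a $ 2)) (max 0 (- a $ 1) + max 0 (- a $ 2))"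

text \<open>A linear function is maximal over an interval at an endpoint, so rounding
  \<open>m\<close> down and \<open>H\<close> up can only increase the maximum.\<close>

lemma max_mult_le:
  fixes c i j m H :: real
  assumes "i \<le> m" "m \<le> H" "H \<le> j"
  shows "max (c * m) (c * H) \<le> max (c * i) (c * j)"
proof (cases "0 \<le> c")
  case True
  with assms have "c * m \<le> c * H" "c * H \<le> c * j"
    by (auto intro: mult_left_mono)
  then show ?thesis
    by auto
next
  case False
  with assms have "c * H \<le> c * m" "c * m \<le> c * i"
    by (auto intro: mult_left_mono_neg)
  then show ?thesis
    by auto
qed

text \<open>The maximum is \<open>c * j\<close> for \<open>c\<close> nonnegative and
  \<open>c * i\<close> otherwise, so only one of the two terms on the right survives, and it equals
  the left side.\<close>

lemma max_mult_minus_le: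
  fixes c i j k :: real
  assumes "i \<le> k" "k \<le> j"
  shows "max (c * i) (c * j) - c * k \<le> max 0 c * (j - k) + max 0 (- c) * (k - i)"
proof (cases "0 \<le> c")
  case True
  with assms have "c * i \<le> c * j"
    by (intro mult_left_mono) auto
  with True show ?thesis
    by (simp add: max_def algebra_simps)
next
  case False
  with assms have "c * j \<le> c * i"
    by (intro mult_left_mono_neg) auto
  with False show ?thesis
    by (simp add: max_def algebra_simps)
qed

text \<open>Summing over both coordinates gives \<open>?P * (j - k) + ?Q * (k - i)\<close>. Both
  coefficients are at most the exponent, and the dependence on \<open>k\<close> cancels.\<close>

lemma entropy_exponent_ge:
  assumes "i \<le> k" "k \<le> j"
  shows "max (a $ 1 * i) (a $ 1 * j) + max (a $ 2 * i) (a $ 2 * j) - (a $ 1 + a $ 2) * k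
    \<le> entropy_exponent a * (j - i)"
proof -
  let ?P = "max 0 (a $ 1) + max 0 (a $ 2)" and ?Q = "max 0 (- a $ 1) + max 0 (- a $ 2)"
  have "max (a $ 1 * i) (a $ 1 * j) + max (a $ 2 * i) (a $ 2 * j) - (a $ 1 + a $ 2) * k
      \<le> ?P * (j - k) + ?Q * (k - i)"
    using add_mono[OF max_mult_minus_le[OF assms, of "a $ 1"] max_mult_minus_le[OF assms, of "a $ 2"]]
    by (simp add: distrib_right)
  also have "\<dots> \<le> entropy_exponent a * (j - k) + entropy_exponent a * (k - i)"
    using assms by (intro add_mono mult_right_mono) (auto simp: entropy_exponent_def)
  finally show ?thesis
    by (simp add: algebra_simps)
qed

text \<open>A triple \<open>(i, j, k)\<close> records the rounded lowest and highest heights of a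
  curve and the rounded height of its endpoint, and determines a box containing that endpoint. There
  are at most \<open>(2 * r + 3) ^ 3\<close> triples, and each box has volume at most
  \<open>?D\<close>.\<close>

lemma emeasure_riem_ball_le:
  assumes r: "0 \<le> r"
  shows "emeasure (riem_volume (metric_g a)) (riem_ball (metric_g a) p r)
    \<le> ennreal ((2 * r + 3) ^ 3 * (4 * r\<^sup>2 * exp (entropy_exponent a * (r + 2) + \<bar>a $ 1 + a $ 2\<bar>)))"
    (is "emeasure ?M _ \<le> ennreal (_ * ?D)")
proof -
  define w where "w n i j = r * exp (max (a $ n * of_int i) (a $ n * of_int j))" for n and i j :: int
  define l where "l = (\<lambda>(i, j, k). vector [p $ 1 - w 1 i j, p $ 2 - w 2 i j, of_int k] :: real^3)"
  define u where "u = (\<lambda>(i, j, k). vector [p $ 1 + w 1 i j, p $ 2 + w 2 i j, of_int k + 1] :: real^3)"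
  define I where "I = {\<lfloor>p $ 3 - r\<rfloor>..\<lceil>p $ 3 + r\<rceil>}"
  define T where "T = {(i, j, k) \<in> I \<times> I \<times> I. i \<le> k \<and> k \<le> j \<and> of_int (j - i) \<le> r + 2}"
  have T_sub: "T \<subseteq> I \<times> I \<times> I" and fin: "finite T"
    by (auto simp: T_def I_def intro: finite_subset[of _ "I \<times> I \<times> I"])
  have w_pos: "0 \<le> w n i j" for n i j
    using r by (simp add: w_def)
  have cover: "riem_ball (metric_g a) p r \<subseteq> (\<Union>\<tau>\<in>T. cbox (l \<tau>) (u \<tau>))"
  proof
    fix q assume "q \<in> riem_ball (metric_g a) p r"
    then obtain m H where mH: "m \<le> p $ 3" "p $ 3 \<le> H" "m \<le> q $ 3" "q $ 3 \<le> H" "H - m < r"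
      "\<bar>q $ 1 - p $ 1\<bar> \<le> r * exp (max (a $ 1 * m) (a $ 1 * H))"
      "\<bar>q $ 2 - p $ 2\<bar> \<le> r * exp (max (a $ 2 * m) (a $ 2 * H))"
      by (rule riem_ball_height_range)
    let ?i = "\<lfloor>m\<rfloor>" and ?j = "\<lceil>H\<rceil>" and ?k = "\<lfloor>q $ 3\<rfloor>"
    \<comment> \<open>As \<open>p $ 3\<close> lies between \<open>m\<close> and \<open>H\<close> and
      \<open>H - m < r\<close>, all three heights are within \<open>r\<close> of
      \<open>p $ 3\<close>. Rounding both ends enlarges \<open>H - m\<close> by less than 2.\<close>
    have "?i \<in> I" "?j \<in> I" "?k \<in> I" "?i \<le> ?k" "?k \<le> ?j" "of_int (?j - ?i) \<le> r + 2"
      using mH unfolding I_def by (simp_all, linarith+)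
    then have "(?i, ?j, ?k) \<in> T"
      by (simp add: T_def)
    moreover have "r * exp (max (a $ n * m) (a $ n * H)) \<le> w n ?i ?j" for n
      unfolding w_def using mH r by (intro mult_left_mono iffD2[OF exp_le_cancel_iff] max_mult_le) auto
    with mH(6,7) have "\<bar>q $ 1 - p $ 1\<bar> \<le> w 1 ?i ?j" "\<bar>q $ 2 - p $ 2\<bar> \<le> w 2 ?i ?j"
      by (meson order_trans)+
    then have "q \<in> cbox (l (?i, ?j, ?k)) (u (?i, ?j, ?k))"
      by (auto simp: mem_box_cart forall_3 l_def u_def)
    ultimately show "q \<in> (\<Union>\<tau>\<in>T. cbox (l \<tau>) (u \<tau>))"
      by blast
  qed
  have box: "emeasure ?M (cbox (l \<tau>) (u \<tau>)) \<le> ennreal ?D" if "\<tau> \<in> T" for \<tau>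
  proof -
    obtain i j k where \<tau>: "\<tau> = (i, j, k)" "i \<le> k" "k \<le> j" "of_int (j - i) \<le> r + 2"
      using \<open>\<tau> \<in> T\<close> by (auto simp: T_def)
    let ?s = "a $ 1 + a $ 2"
    \<comment> \<open>Between the heights \<open>k\<close> and \<open>k + 1\<close> the density
      exceeds its value at \<open>k\<close> by a factor of at most
      \<open>exp \<bar>?s\<bar>\<close>.\<close>
    have "emeasure ?M (cbox (l \<tau>) (u \<tau>)) \<le> ennreal (exp (- ?s * of_int k + \<bar>?s\<bar>) *
        ((u \<tau> $ 1 - l \<tau> $ 1) * (u \<tau> $ 2 - l \<tau> $ 2) * (u \<tau> $ 3 - l \<tau> $ 3)))"
    proof (rule emeasure_riem_volume_cbox_le)
      fix n :: 3
      show "l \<tau> $ n \<le> u \<tau> $ n"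
        using w_pos[of 1 i j] w_pos[of 2 i j] exhaust_3[of n] by (auto simp: l_def u_def \<tau>(1))
    next
      fix q assume "q \<in> cbox (l \<tau>) (u \<tau>)"
      then have "\<bar>of_int k - q $ 3\<bar> \<le> 1"
        by (auto simp: mem_box_cart forall_3 l_def u_def \<tau>(1))
      then have "\<bar>?s * (of_int k - q $ 3)\<bar> \<le> \<bar>?s\<bar>"
        by (simp add: abs_mult mult_left_le)
      then show "exp (- ?s * q $ 3) \<le> exp (- ?s * of_int k + \<bar>?s\<bar>)"
        by (simp add: algebra_simps)
    qed simp
    also have "exp (- ?s * of_int k + \<bar>?s\<bar>) *
        ((u \<tau> $ 1 - l \<tau> $ 1) * (u \<tau> $ 2 - l \<tau> $ 2) * (u \<tau> $ 3 - l \<tau> $ 3)) =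
      4 * r\<^sup>2 * exp ((max (a $ 1 * i) (a $ 1 * j) + max (a $ 2 * i) (a $ 2 * j) - ?s * k) + \<bar>?s\<bar>)"
      by (simp add: l_def u_def \<tau>(1) w_def exp_add exp_diff exp_minus power2_eq_square field_simps)
    also have "\<dots> \<le> ?D"
    proof -
      have "max (a $ 1 * i) (a $ 1 * j) + max (a $ 2 * i) (a $ 2 * j) - ?s * k \<le> entropy_exponent a * of_int (j - i)"
        unfolding of_int_diff using \<tau> by (intro entropy_exponent_ge) auto
      also have "\<dots> \<le> entropy_exponent a * (r + 2)"
        using \<tau>(4) by (intro mult_left_mono) (auto simp: entropy_exponent_def)
      finally show ?thesis
        by (intro mult_left_mono) auto
    qed
    finally show ?thesis
      by (simp add: ennreal_leI)
  qed
  have "emeasure ?M (riem_ball (metric_g a) p r) \<le> emeasure ?M (\<Union>\<tau>\<in>T. cbox (l \<tau>) (u \<tau>))"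
    using fin by (intro emeasure_mono cover) (auto simp: riem_volume_def)
  also have "\<dots> \<le> (\<Sum>\<tau>\<in>T. emeasure ?M (cbox (l \<tau>) (u \<tau>)))"
    using fin by (intro emeasure_subadditive_finite) (auto simp: riem_volume_def)
  also have "\<dots> \<le> (\<Sum>\<tau>\<in>T. ennreal ?D)"
    by (intro sum_mono box)
  also have "\<dots> = ennreal (card T * ?D)"
    by (simp add: ennreal_mult ennreal_of_nat_eq_real_of_nat)
  also have "card T * ?D \<le> (2 * r + 3) ^ 3 * ?D"
  proof (intro mult_right_mono)
    \<comment> \<open>The bounds of \<open>I\<close> come from points \<open>2 * r\<close> apart:
      rounding adds less than 2, and counting both ends adds 1.\<close>
    have "real (card I) \<le> 2 * r + 3"
      unfolding I_def using r by simp linarith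
    have "card T \<le> card (I \<times> I \<times> I)"
      by (intro card_mono T_sub) (simp add: I_def)
    then have "real (card T) \<le> real (card I) ^ 3"
      unfolding of_nat_power[symmetric] of_nat_le_iff
      by (simp add: card_cartesian_product power3_eq_cube mult.assoc)
    also have "\<dots> \<le> (2 * r + 3) ^ 3"
      by (intro power_mono \<open>real (card I) \<le> 2 * r + 3\<close>) simp
    finally show "real (card T) \<le> (2 * r + 3) ^ 3" .
  qed simp
  finally show ?thesis
    by (simp add: ennreal_leI)
qed

section \<open>Lower bound for the volume of balls\<close>

text \<open>Each horizontal coordinate can be changed either at height \<open>p $ 3\<close> or at height \<open>z\<close>, so that
  a box of widths \<open>max 1 (exp (a $ n * z))\<close> at height \<open>z\<close> is reached at bounded extra cost.\<close>

lemma emeasure_riem_ball_ge: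
  assumes r: "\<bar>z - p $ 3\<bar> + 1 + (\<Sum>n\<in>UNIV. exp (- a $ n * p $ 3) + exp \<bar>a $ n\<bar>) < r"
  shows "ennreal (exp (- \<bar>a $ 1 + a $ 2\<bar>) * (max 1 (exp (- a $ 1 * z)) * max 1 (exp (- a $ 2 * z))))
    \<le> emeasure (riem_volume (metric_g a)) (riem_ball (metric_g a) p r)"
proof -
  let ?M = "riem_volume (metric_g a)" and ?s = "a $ 1 + a $ 2"
  define w where "w n = max 1 (exp (a $ n * z))" for n
  define l u :: "real^3"
    where "l = vector [p $ 1, p $ 2, z]" and "u = vector [p $ 1 + w 1, p $ 2 + w 2, z + 1]"
  \<comment> \<open>For width 1 the coordinate is changed at height \<open>p $ 3\<close>. For width
    \<open>exp (a $ n * z)\<close> it is changed at the final height \<open>t\<close>, which differs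
    from \<open>z\<close> by at most 1.\<close>
  have cost: "min (exp (- a $ n * p $ 3)) (exp (- a $ n * t)) * d \<le> exp (- a $ n * p $ 3) + exp \<bar>a $ n\<bar>"
    if "z \<le> t" "t \<le> z + 1" "0 \<le> d" "d \<le> w n" for n t d
  proof (cases "w n = 1")
    case True
    have "min (exp (- a $ n * p $ 3)) (exp (- a $ n * t)) * d \<le> exp (- a $ n * p $ 3) * 1"
      using that True by (intro mult_mono) auto
    then show ?thesis
      using exp_ge_zero[of "\<bar>a $ n\<bar>"] by linarith
  next
    case False
    then have "w n = exp (a $ n * z)"
      by (auto simp: w_def max_def)
    then have "min (exp (- a $ n * p $ 3)) (exp (- a $ n * t)) * d \<le> exp (- a $ n * t) * exp (a $ n * z)"
      using that by (intro mult_mono) auto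
    also have "\<dots> = exp (a $ n * (z - t))"
      by (simp add: exp_add[symmetric] algebra_simps)
    also have "\<dots> \<le> exp \<bar>a $ n\<bar>"
    proof -
      have "\<bar>a $ n * (z - t)\<bar> \<le> \<bar>a $ n\<bar>"
        using that by (simp add: abs_mult mult_left_le)
      then show ?thesis
        by simp
    qed
    finally show ?thesis
      using exp_ge_zero[of "- a $ n * p $ 3"] by linarith
  qed
  have sub: "cbox l u \<subseteq> riem_ball (metric_g a) p r"
  proof
    fix q assume "q \<in> cbox l u"
    then have q: "p $ 1 \<le> q $ 1" "q $ 1 \<le> p $ 1 + w 1" "p $ 2 \<le> q $ 2" "q $ 2 \<le> p $ 2 + w 2"
      "z \<le> q $ 3" "q $ 3 \<le> z + 1"
      by (auto simp: mem_box_cart forall_3 l_def u_def)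
    have "min (exp (- a $ 1 * p $ 3)) (exp (- a $ 1 * q $ 3)) * \<bar>q $ 1 - p $ 1\<bar>
        \<le> exp (- a $ 1 * p $ 3) + exp \<bar>a $ 1\<bar>"
      "min (exp (- a $ 2 * p $ 3)) (exp (- a $ 2 * q $ 3)) * \<bar>q $ 2 - p $ 2\<bar>
        \<le> exp (- a $ 2 * p $ 3) + exp \<bar>a $ 2\<bar>"
      using q by (intro cost; simp)+
    moreover have "\<bar>q $ 3 - p $ 3\<bar> \<le> \<bar>z - p $ 3\<bar> + 1"
      using q by linarith
    ultimately have "min (exp (- a $ 1 * p $ 3)) (exp (- a $ 1 * q $ 3)) * \<bar>q $ 1 - p $ 1\<bar> +
      min (exp (- a $ 2 * p $ 3)) (exp (- a $ 2 * q $ 3)) * \<bar>q $ 2 - p $ 2\<bar> + \<bar>q $ 3 - p $ 3\<bar> < r"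
      using r unfolding sum_2 by linarith
    then show "q \<in> riem_ball (metric_g a) p r"
      unfolding mem_riem_ball_metric_g using curve_of_length_metric_g by blast
  qed
  \<comment> \<open>The density at height \<open>z\<close> factors over the two coordinates, and
    each factor is absorbed into the corresponding width.\<close>
  have w_eq: "exp (- a $ n * z) * w n = max 1 (exp (- a $ n * z))" for n
    by (simp add: w_def max_mult_distrib_left exp_add[symmetric] max.commute)
  have "exp (- \<bar>?s\<bar>) * (max 1 (exp (- a $ 1 * z)) * max 1 (exp (- a $ 2 * z)))
      = exp (- ?s * z - \<bar>?s\<bar>) * ((u $ 1 - l $ 1) * (u $ 2 - l $ 2) * (u $ 3 - l $ 3))"
    unfolding w_eq[symmetric] by (simp add: l_def u_def exp_add exp_diff exp_minus field_simps)
  also have "ennreal \<dots> \<le> emeasure ?M (cbox l u)"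
  proof (rule emeasure_riem_volume_cbox_ge)
    fix n :: 3
    show "l $ n \<le> u $ n"
      using exhaust_3[of n] by (auto simp: l_def u_def w_def)
  next
    fix q assume "q \<in> cbox l u"
    then have "\<bar>z - q $ 3\<bar> \<le> 1"
      by (auto simp: mem_box_cart forall_3 l_def u_def)
    then have "\<bar>?s * (z - q $ 3)\<bar> \<le> \<bar>?s\<bar>"
      by (simp add: abs_mult mult_left_le)
    then show "exp (- ?s * z - \<bar>?s\<bar>) \<le> exp (- ?s * q $ 3)"
      by (simp add: algebra_simps)
  qed simp
  also have "\<dots> \<le> emeasure ?M (riem_ball (metric_g a) p r)"
    by (intro emeasure_mono sub) (simp add: riem_volume_def open_riem_ball_metric_g)
  finally show ?thesis .
qed

lemma riem_ball_volume_exponential_lower_bound: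
  obtains c r0 where "c > 0"
    "\<forall>r\<ge>r0. ennreal (c * exp (entropy_exponent a * r))
      \<le> emeasure (riem_volume (metric_g a)) (riem_ball (metric_g a) p r)"
proof -
  \<comment> \<open>One more than the fixed cost in \<open>emeasure_riem_ball_ge\<close>, so that a
    vertical move of \<open>r - K\<close> satisfies its strict inequality.\<close>
  define K where "K = 2 + (\<Sum>n\<in>UNIV. exp (- a $ n * p $ 3) + exp \<bar>a $ n\<bar>)"
  define P Q where "P = max 0 (a $ 1) + max 0 (a $ 2)" and "Q = max 0 (- a $ 1) + max 0 (- a $ 2)"
  define b where "b = exp (- \<bar>a $ 1 + a $ 2\<bar>)"
  \<comment> \<open>The entries of the minimum are what remains of \<open>exp (P * (- z))\<close>
    and \<open>exp (Q * z)\<close> after removing \<open>exp (P * r)\<close> and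
    \<open>exp (Q * r)\<close>, for \<open>z\<close> at distance \<open>r - K\<close> below and
    above \<open>p $ 3\<close>.\<close>
  define c where "c = b * min (exp (- P * (p $ 3 + K))) (exp (- Q * (K - p $ 3)))"
  let ?v = "\<lambda>r. emeasure (riem_volume (metric_g a)) (riem_ball (metric_g a) p r)"
  \<comment> \<open>Each right side is either 1 or \<open>exp (- a $ n * z)\<close>, depending on
    the sign of \<open>a $ n\<close>.\<close>
  have "max 1 (exp (- a $ n * z)) \<ge> exp (max 0 (a $ n) * (- z))"
    "max 1 (exp (- a $ n * z)) \<ge> exp (max 0 (- a $ n) * z)" for n z
    by (auto simp: max_def)
  then have PQ: "max 1 (exp (- a $ 1 * z)) * max 1 (exp (- a $ 2 * z)) \<ge> exp (P * (- z))"
    "max 1 (exp (- a $ 1 * z)) * max 1 (exp (- a $ 2 * z)) \<ge> exp (Q * z)" for z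
    unfolding P_def Q_def distrib_right exp_add by (intro mult_mono; simp)+
  have "ennreal (c * exp (entropy_exponent a * r)) \<le> ?v r" if "r \<ge> K" for r
  proof (cases "Q \<le> P")
    case True
    let ?z = "p $ 3 - (r - K)"
    have "c * exp (entropy_exponent a * r) \<le> b * exp (- P * (p $ 3 + K)) * exp (P * r)"
      using True by (auto simp: c_def entropy_exponent_def b_def P_def[symmetric] Q_def[symmetric]
          intro!: mult_mono)
    also have "\<dots> = b * exp (P * (- ?z))"
      by (simp add: exp_add[symmetric] algebra_simps)
    also have "\<dots> \<le> b * (max 1 (exp (- a $ 1 * ?z)) * max 1 (exp (- a $ 2 * ?z)))"
      by (intro mult_left_mono PQ) (simp add: b_def)
    also have "ennreal \<dots> \<le> ?v r"
      unfolding b_def using that by (intro emeasure_riem_ball_ge) (simp add: K_def)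
    finally show ?thesis
      by (simp add: ennreal_leI)
  next
    case False
    let ?z = "p $ 3 + (r - K)"
    have "c * exp (entropy_exponent a * r) \<le> b * exp (- Q * (K - p $ 3)) * exp (Q * r)"
      using False by (auto simp: c_def entropy_exponent_def b_def P_def[symmetric] Q_def[symmetric]
          intro!: mult_mono)
    also have "\<dots> = b * exp (Q * ?z)"
      by (simp add: exp_add[symmetric] algebra_simps)
    also have "\<dots> \<le> b * (max 1 (exp (- a $ 1 * ?z)) * max 1 (exp (- a $ 2 * ?z)))"
      by (intro mult_left_mono PQ) (simp add: b_def)
    also have "ennreal \<dots> \<le> ?v r"
      unfolding b_def using that by (intro emeasure_riem_ball_ge) (simp add: K_def)
    finally show ?thesis
      by (simp add: ennreal_leI)
  qed
  moreover have "c > 0"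
    by (simp add: c_def b_def)
  ultimately show thesis
    using that by blast
qed

section \<open>The volume entropy\<close>

theorem has_volume_entropy_metric_g: "has_volume_entropy (metric_g a) (entropy_exponent a)"
  unfolding has_volume_entropy_def
proof
  fix p
  let ?\<delta> = "entropy_exponent a" and ?A = "\<bar>a $ 1 + a $ 2\<bar>"
  let ?V = "\<lambda>r. measure (riem_volume (metric_g a)) (riem_ball (metric_g a) p r)"
  let ?U = "\<lambda>r. (2 * r + 3) ^ 3 * (4 * r\<^sup>2 * exp (?\<delta> * (r + 2) + ?A))"
  obtain c r0 where c: "c > 0" and lower: "\<forall>r\<ge>r0. ennreal (c * exp (?\<delta> * r))
      \<le> emeasure (riem_volume (metric_g a)) (riem_ball (metric_g a) p r)"
    by (rule riem_ball_volume_exponential_lower_bound[where a = a and p = p])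
  have V: "c * exp (?\<delta> * r) \<le> ?V r" "?V r \<le> ?U r" if "r \<ge> r0" "r > 0" for r
  proof -
    have U: "emeasure (riem_volume (metric_g a)) (riem_ball (metric_g a) p r) \<le> ennreal (?U r)"
      using that by (intro emeasure_riem_ball_le) simp
    \<comment> \<open>\<open>measure\<close> is 0 on sets of infinite measure, so the lower bound
      passes to \<open>?V\<close> only once the upper bound has shown finiteness.\<close>
    then have "emeasure (riem_volume (metric_g a)) (riem_ball (metric_g a) p r) = ennreal (?V r)"
      by (intro emeasure_eq_ennreal_measure) (auto simp: top_unique)
    with U lower that(1) show "c * exp (?\<delta> * r) \<le> ?V r" "?V r \<le> ?U r"
      using that by (auto simp: ennreal_le_iff)
  qed
  \<comment> \<open>After taking logarithms and dividing by \<open>r\<close>, the constants and the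
    polynomial factor vanish in the limit, and both bounds tend to \<open>?\<delta>\<close>.\<close>
  show "((\<lambda>r. ln (?V r) / r) \<longlongrightarrow> ?\<delta>) at_top"
  proof (rule tendsto_sandwich)
    show "\<forall>\<^sub>F r in at_top. (ln c + ?\<delta> * r) / r \<le> ln (?V r) / r"
      using eventually_ge_at_top[of r0] eventually_gt_at_top[of 0]
    proof eventually_elim
      case (elim r)
      have "ln c + ?\<delta> * r = ln (c * exp (?\<delta> * r))"
        using c by (simp add: ln_mult)
      also have "\<dots> \<le> ln (?V r)"
        using V(1)[OF elim] c by (intro ln_mono) auto
      finally show ?case
        using elim by (simp add: divide_right_mono)
    qed
    show "\<forall>\<^sub>F r in at_top. ln (?V r) / r
        \<le> (3 * ln (2 * r + 3) + ln 4 + 2 * ln r + (?\<delta> * (r + 2) + ?A)) / r"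
      using eventually_ge_at_top[of r0] eventually_gt_at_top[of 0]
    proof eventually_elim
      case (elim r)
      have "0 < ?V r"
        using V(1)[OF elim] c by (meson exp_gt_zero less_le_trans mult_pos_pos)
      then have "ln (?V r) \<le> ln (?U r)"
        using V(2)[OF elim] by (intro ln_mono) auto
      also have "\<dots> = 3 * ln (2 * r + 3) + ln 4 + 2 * ln r + (?\<delta> * (r + 2) + ?A)"
        using elim by (simp add: ln_mult ln_realpow)
      finally show ?case
        using elim by (simp add: divide_right_mono)
    qed
    show "((\<lambda>r. (ln c + ?\<delta> * r) / r) \<longlongrightarrow> ?\<delta>) at_top"
      by real_asymp
    show "((\<lambda>r. (3 * ln (2 * r + 3) + ln 4 + 2 * ln r + (?\<delta> * (r + 2) + ?A)) / r) \<longlongrightarrow> ?\<delta>) at_top"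
      by real_asymp
  qed
qed

theorem corollary2:
  fixes \<alpha> :: real
  shows "has_volume_entropy (metric_g (vector [1, - \<alpha>]))
           (if \<alpha> < 0 then 1 - \<alpha> else if \<alpha> \<le> 1 then 1 else \<alpha>)"
proof -
  \<comment> \<open>Here \<open>P = 1 + max 0 (- \<alpha>)\<close> and
    \<open>Q = max 0 \<alpha>\<close>; \<open>Q\<close> overtakes \<open>P\<close> at
    \<open>\<alpha> = 1\<close>.\<close>
  have "entropy_exponent (vector [1, - \<alpha>]) =
      (if \<alpha> < 0 then 1 - \<alpha> else if \<alpha> \<le> 1 then 1 else \<alpha>)"
    by (auto simp: entropy_exponent_def max_def)
  then show ?thesis
    using has_volume_entropy_metric_g[of "vector [1, - \<alpha>]"] by simp
qed

end
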